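(* For every real $d>0$, as $n\to\infty$, $$\log p_d(n)\sim c_d\cdot n^{1/(d+1)},\qquad\text{where}\qquad c_d=(d+1)\left(\frac1d\cdot\Gamma\left(1+\frac1d\right)\cdot\zeta\left(1+\frac1d\right)\right)^{\frac{d}{d+1}}.$$
   Context: $\mathbb{N}_+$ denotes the positive integers. For a non-decreasing $\sigma\colon\mathbb{N}_+\to\mathbb{N}_+$, $p_\sigma(n)$ denotes the number of finite sequences of positive integers $a_1\le a_2\le\dots\le a_k$ (of any length $k$) such that $\sum_{i=1}^k\sigma(a_i)=n$. For real $d>0$ and a nonnegative integer $n$, $p_d(n)$ denotes $p_\sigma(n)$ with $\sigma(x)=\lfloor x^d\rfloor$. (When $\sigma$ is not injective, sequences $(a_i)$ that differ are counted separately even if the values $\sigma(a_i)$ coincide.) $\Gamma(z)=\int_0^\infty t^{z-1}e^{-t}\,dt$ is the Gamma function and $\zeta(s)=\sum_{n=1}^\infty n^{-s}$ is the zeta function. $\log$ is the natural logarithm, and $g(n)\sim h(n)$ means $g(n)/h(n)\to1$. *)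

theory Defs
  imports "HOL-Analysis.Gamma_Function" "HOL-Library.Landau_Symbols"
begin

(* A nondecreasing sequence a_1 <= ... <= a_k of positive integers is a sorted list
   (k = 0 included). Distinct lists count separately even if their images under sigma
   coincide. The set is finite whenever sigma is positive on the positive integers
   and tends to infinity, so that card is then the honest number of sequences;
   this covers every function used in p_pow below. The value sigma 0 is irrelevant. *)
definition p_sigma :: "(nat \<Rightarrow> nat) \<Rightarrow> nat \<Rightarrow> nat" where
  "p_sigma \<sigma> n = card {as. sorted as \<and> (\<forall>a\<in>set as. 0 < a) \<and> (\<Sum>a\<leftarrow>as. \<sigma> a) = n}"

definition p_pow :: "real \<Rightarrow> nat \<Rightarrow> nat" where
  "p_pow d n = p_sigma (\<lambda>x. nat \<lfloor>real x powr d\<rfloor>) n"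

(* The Riemann zeta function on the half-line s > 1, where the series converges;
   the index is shifted so that the sum starts at 1. *)
definition zeta :: "real \<Rightarrow> real" where
  "zeta s = (\<Sum>n. real (Suc n) powr (- s))"

definition c_pow :: "real \<Rightarrow> real" where
  "c_pow d = (d + 1) * (1 / d * Gamma (1 + 1 / d) * zeta (1 + 1 / d)) powr (d / (d + 1))"

end

theory Submission
  imports Defs "HOL-Analysis.Analysis"
begin

text \<open>
  Let \<open>\<alpha> = 1 / d\<close> and \<open>\<sigma> a = \<lfloor>a\<^sup>d\<rfloor>\<close>. The generating function of the partition numbers is
  \<open>F t = (\<Sum>n. p n exp (- t n)) = (\<Prod>a. 1 / (1 - exp (- t \<sigma> a)))\<close>, and expanding the logarithm gives
  \<open>ln (F t) = (\<Sum>k. E (t k) / k)\<close> with \<open>E s = (\<Sum>a. exp (- s \<sigma> a))\<close>. Comparison with an integral shows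
  \<open>s\<^sup>\<alpha> E s \<longlongrightarrow> \<Gamma>(1 + \<alpha>)\<close> as \<open>s \<longlongrightarrow> 0\<close>, with \<open>s\<^sup>\<alpha> E s\<close> bounded for all \<open>s > 0\<close>; by dominated convergence
  \<open>t\<^sup>\<alpha> ln (F t) \<longlongrightarrow> \<Gamma>(1 + \<alpha>) \<zeta>(1 + \<alpha>)\<close>. Since \<open>\<sigma> 1 = 1\<close>, \<open>p\<close> is non-decreasing, so a Tauberian argument
  applies: \<open>p n \<le> F t exp (t n)\<close> at the optimal \<open>t\<close> is the upper bound, and Chernoff bounds show that
  for \<open>t\<close> slightly above the optimum the mass of \<open>F t\<close> sits on indices just below \<open>n\<close>, which by
  monotonicity forces \<open>p n\<close> to be large.
\<close>

subsection \<open>A Tauberian theorem\<close>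

text \<open>Strict convexity: the graph of r^(-\<alpha>) lies above its tangent at 1. The strictness
  later yields an exponential gap between the main term and the Chernoff errors.\<close>

lemma powr_minus_gt_tangent:
  fixes r \<alpha> :: real
  assumes "r > 0" "r \<noteq> 1" "\<alpha> > 0"
  shows "1 - \<alpha> * (r - 1) < r powr (-\<alpha>)"
proof -
  have "ln r < r - 1"
    using assms ln_le_minus_one[of r] ln_eq_minus_one[of r] by fastforce
  hence "1 - \<alpha> * (r - 1) < 1 + (-\<alpha>) * ln r"
    using mult_strict_left_mono[of "ln r" "r - 1" \<alpha>] assms by simp
  also have "\<dots> \<le> exp ((-\<alpha>) * ln r)" by (rule exp_ge_add_one_self)
  also have "\<dots> = r powr (-\<alpha>)" using assms by (simp add: powr_def)
  finally show ?thesis .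
qed

text \<open>All that the Tauberian argument needs of the partition numbers. Monotonicity and
  \<open>p 0 > 0\<close> make every coefficient positive, so that \<open>ln (p n)\<close> is
  meaningful.\<close>

locale monotone_exp_series =
  fixes p :: "nat \<Rightarrow> real" and F :: "real \<Rightarrow> real"
  assumes mono: "mono p" and pos: "0 < p 0"
    and sums: "\<And>t. t > 0 \<Longrightarrow> (\<lambda>n. p n * exp (- (t * real n))) sums F t"
begin

lemma coeff_pos: "0 < p n"
  using mono pos by (meson le0 less_le_trans monoD)

lemma coeff_le:
  assumes "t > 0"
  shows "p n \<le> F t * exp (t * real n)"
proof -
  have "p n * exp (- (t * real n)) \<le> F t"
    using sum_le_suminf[OF sums_summable[OF sums[OF assms]], of "{n}"] coeff_pos
      sums_unique[OF sums[OF assms]] by (simp add: less_imp_le)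
  hence "p n * exp (- (t * real n)) * exp (t * real n) \<le> F t * exp (t * real n)"
    by (rule mult_right_mono) simp
  thus ?thesis by (simp add: mult.assoc flip: exp_add)
qed

lemma F_pos: "t > 0 \<Longrightarrow> 0 < F t"
  using coeff_le[of t 0] pos by simp

text \<open>Chernoff bounds with the exponents \<open>a < t < b\<close> for the terms above \<open>n\<close> and below \<open>w\<close>;
  monotonicity of \<open>p\<close> for the terms in between.\<close>
lemma F_le_split:
  assumes "0 < a" "a < t" "t < b"
  shows "F t \<le> F a * exp (- ((t - a) * real n)) + F b * exp ((b - t) * w)
               + (real n + 1) * (p n * exp (- (t * w)))"
proof -
  have t: "0 < t" "0 < b" using assms by auto
  let ?c = "p n * exp (- (t * w))"
  \<comment> \<open>The bound for the middle range is charged to all n + 1 indices up to n,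
    including those below w. The resulting factor n + 1 is negligible on the exponential
    scale.\<close>
  have "(\<lambda>m. if m \<in> {..n} then ?c else 0) sums (\<Sum>m\<in>{..n}. ?c)"
    by (rule sums_If_finite_set) simp
  hence 1: "(\<lambda>m. if m \<le> n then ?c else 0) sums ((real n + 1) * ?c)"
    by (simp add: add.commute)
  note S = sums_add[OF sums_add[OF sums_mult2[OF sums[OF assms(1)]] sums_mult2[OF sums[OF t(2)]]] 1]
  show ?thesis
  proof (rule sums_le[OF _ sums[OF t(1)] S])
    fix m
    let ?A = "p m * exp (- (a * real m)) * exp (- ((t - a) * real n))"
    let ?B = "p m * exp (- (b * real m)) * exp ((b - t) * w)"
    let ?C = "if m \<le> n then ?c else 0"
    have nn: "0 \<le> ?A" "0 \<le> ?B" "0 \<le> ?C" using coeff_pos by (auto simp: less_imp_le)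
    consider "n < m" | "real m < w" | "m \<le> n" "w \<le> real m" by linarith
    thus "p m * exp (- (t * real m)) \<le> ?A + ?B + ?C"
    proof cases
      case 1
      hence "(t - a) * real n \<le> (t - a) * real m" using assms by (intro mult_left_mono) auto
      hence "p m * exp (- (t * real m)) \<le> p m * exp (- (a * real m) - (t - a) * real n)"
        using coeff_pos[of m] by (simp add: algebra_simps)
      hence "p m * exp (- (t * real m)) \<le> ?A" by (simp add: exp_diff exp_minus divide_inverse mult.assoc)
      thus ?thesis using nn by linarith
    next
      case 2
      hence "(b - t) * real m \<le> (b - t) * w" using assms by (intro mult_left_mono) auto
      hence "p m * exp (- (t * real m)) \<le> p m * exp (- (b * real m) + (b - t) * w)"
        using coeff_pos[of m] by (simp add: algebra_simps)
      hence "p m * exp (- (t * real m)) \<le> ?B" unfolding exp_add by (simp only: mult.assoc)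
      thus ?thesis using nn by linarith
    next
      case 3
      hence "p m * exp (- (t * real m)) \<le> ?c"
        using coeff_pos[of m] t monoD[OF mono, of m n] by (intro mult_mono) auto
      thus ?thesis using 3 nn by simp
    qed
  qed
qed

end

text \<open>A strict gap between the limits, multiplied by y, makes Z - X tend to infinity, so any
  constant factor is absorbed. A quarter is chosen because two such errors must leave half of the
  main term.\<close>

lemma eventually_exp_le_quarter:
  fixes X Z y :: "nat \<Rightarrow> real"
  assumes "(\<lambda>n. X n / y n) \<longlonglongrightarrow> l1" "(\<lambda>n. Z n / y n) \<longlonglongrightarrow> l2" "l1 < l2"
    "filterlim y at_top sequentially"
  shows "eventually (\<lambda>n. exp (X n) \<le> exp (Z n) / 4) sequentially"
proof -
  have "filterlim (\<lambda>n. (Z n / y n - X n / y n) * y n) at_top sequentially"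
    using assms by (intro filterlim_tendsto_pos_mult_at_top[OF tendsto_diff]) auto
  hence "eventually (\<lambda>n. ln 4 \<le> (Z n / y n - X n / y n) * y n) sequentially"
    by (simp add: filterlim_at_top)
  moreover have "eventually (\<lambda>n. y n > 0) sequentially"
    using assms(4) by (simp add: filterlim_at_top_dense)
  ultimately show ?thesis
  proof eventually_elim
    case (elim n)
    have "(Z n / y n - X n / y n) * y n = Z n - X n" using elim(2) by (simp add: left_diff_distrib)
    hence "X n \<le> Z n - ln 4" using elim(1) by simp
    hence "exp (X n) \<le> exp (Z n - ln 4)" by simp
    thus ?case by (simp add: exp_diff)
  qed
qed

section \<open>Asymptotics of the logarithm of the coefficients\<close>

context monotone_exp_series
begin

lemma ln_coeff_asymptotics:
  assumes "\<alpha> > 0" "C > 0"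
    and lim: "((\<lambda>t. t powr \<alpha> * ln (F t)) \<longlongrightarrow> C) (at_right 0)"
  shows "(\<lambda>n. ln (p n) / real n powr (\<alpha> / (1 + \<alpha>)))
           \<longlonglongrightarrow> (1 + 1 / \<alpha>) * (\<alpha> * C) powr (1 / (1 + \<alpha>))"
proof -
  \<comment> \<open>C t^(-\<alpha>) + t n is minimal where t^(1 + \<alpha>) = \<alpha> C / n. That
    point is \<open>\<tau> n\<close>; with \<open>y n\<close> equal to \<open>\<tau> n * n\<close>,
    the minimum is (1 + 1/\<alpha>) y n.\<close>
  define K where "K = (\<alpha> * C) powr (1 / (1 + \<alpha>))"
  define \<beta> where "\<beta> = \<alpha> / (1 + \<alpha>)"
  define \<tau> where "\<tau> n = K * real n powr (- (1 / (1 + \<alpha>)))" for n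
  define y where "y n = K * real n powr \<beta>" for n
  have K: "K > 0" using assms by (simp add: K_def)
  have \<beta>: "\<beta> > 0" using assms by (simp add: \<beta>_def)
  have \<tau>_pos: "\<tau> n > 0" if "n > 0" for n using that K by (simp add: \<tau>_def)
  have y_pos: "y n > 0" if "n > 0" for n using that K by (simp add: y_def)
  have \<beta>1: "1 - 1 / (1 + \<alpha>) = \<beta>" using assms by (simp add: \<beta>_def field_simps)
  have n\<tau>: "\<tau> n * real n = y n" if "n > 0" for n
  proof -
    have "real n powr (- (1 / (1 + \<alpha>))) * real n powr 1 = real n powr \<beta>"
      unfolding powr_add[symmetric] using \<beta>1 by (simp add: add.commute)
    thus ?thesis using that by (simp add: \<tau>_def y_def)
  qed
  have K\<alpha>: "K powr (-\<alpha>) = K / (\<alpha> * C)"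
  proof -
    have "K powr (1 + \<alpha>) = \<alpha> * C" using assms by (simp add: K_def powr_powr)
    hence "K powr (-\<alpha>) * (\<alpha> * C) = K powr (-\<alpha>) * K powr (1 + \<alpha>)" by simp
    also have "\<dots> = K" using K by (simp flip: powr_add)
    finally show ?thesis using assms by (simp add: field_simps)
  qed
  have \<tau>\<alpha>: "\<tau> n powr (-\<alpha>) = y n / (\<alpha> * C)" if "n > 0" for n
    using K \<open>\<alpha> > 0\<close> K\<alpha> by (simp add: \<tau>_def y_def \<beta>_def powr_mult powr_powr)
  have \<tau>_lim: "\<tau> \<longlonglongrightarrow> 0"
  proof -
    have "(\<lambda>n. K * real n powr (- (1 / (1 + \<alpha>)))) \<longlonglongrightarrow> K * 0"
      using \<open>\<alpha> > 0\<close> by (intro tendsto_mult tendsto_const tendsto_neg_powr filterlim_real_sequentially) simp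
    thus ?thesis by (simp add: \<tau>_def[abs_def])
  qed
  have y_lim: "filterlim y at_top sequentially"
    unfolding y_def[abs_def] using K \<beta>
    by (intro filterlim_tendsto_pos_mult_at_top[OF tendsto_const]
          filterlim_compose[OF real_powr_at_top filterlim_real_sequentially]) auto
  \<comment> \<open>At the scale \<open>\<tau> n\<close> every exponent is asymptotically a multiple
    of \<open>y n\<close>, and the rest of the argument concerns the fixed convex function
    u^(-\<alpha>) / \<alpha>.\<close>
  have A: "(\<lambda>n. ln (F (u * \<tau> n)) / y n) \<longlonglongrightarrow> u powr (-\<alpha>) / \<alpha>" if u: "u > 0" for u
  proof -
    have "(\<lambda>n. u * \<tau> n) \<longlonglongrightarrow> u * 0" by (intro tendsto_mult tendsto_const \<tau>_lim)
    moreover have "eventually (\<lambda>n. u * \<tau> n \<in> {0<..} \<and> u * \<tau> n \<noteq> 0) sequentially"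
      using eventually_gt_at_top[of 0] by eventually_elim (use u \<tau>_pos in \<open>simp add: less_imp_neq[symmetric]\<close>)
    ultimately have "filterlim (\<lambda>n. u * \<tau> n) (at_right 0) sequentially"
      by (simp add: filterlim_at)
    from filterlim_compose[OF lim this]
    have "(\<lambda>n. (u * \<tau> n) powr \<alpha> * ln (F (u * \<tau> n)) * (u powr (-\<alpha>) / (\<alpha> * C)))
            \<longlonglongrightarrow> C * (u powr (-\<alpha>) / (\<alpha> * C))"
      by (intro tendsto_mult tendsto_const)
    moreover have "eventually (\<lambda>n. (u * \<tau> n) powr \<alpha> * ln (F (u * \<tau> n)) * (u powr (-\<alpha>) / (\<alpha> * C))
         = ln (F (u * \<tau> n)) / y n) sequentially"
      using eventually_gt_at_top[of 0]
    proof eventually_elim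
      case (elim n)
      have "\<tau> n powr (-\<alpha>) * (\<alpha> * C) = y n" "\<tau> n powr (-\<alpha>) \<noteq> 0"
        using \<tau>\<alpha>[OF elim] \<tau>_pos[OF elim] y_pos[OF elim] assms by simp_all
      hence "\<alpha> * C = y n / \<tau> n powr (-\<alpha>)"
        by (metis nonzero_mult_div_cancel_left)
      thus ?case using u \<tau>_pos[OF elim] y_pos[OF elim]
        by (simp add: powr_mult powr_minus field_simps)
    qed
    ultimately have "(\<lambda>n. ln (F (u * \<tau> n)) / y n) \<longlonglongrightarrow> C * (u powr (-\<alpha>) / (\<alpha> * C))"
      by (rule Lim_transform_eventually)
    thus ?thesis using assms by (simp add: field_simps)
  qed
  \<comment> \<open>The single-term bound \<open>coeff_le\<close> at the optimal parameter, that is,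
    u = 1.\<close>
  have upper: "eventually (\<lambda>n. ln (p n) / y n < c) sequentially" if c: "1 + 1 / \<alpha> < c" for c
  proof -
    have "(\<lambda>n. ln (F (1 * \<tau> n)) / y n + 1) \<longlonglongrightarrow> 1 powr (-\<alpha>) / \<alpha> + 1"
      by (intro tendsto_add tendsto_const A) simp
    hence "eventually (\<lambda>n. ln (F (1 * \<tau> n)) / y n + 1 < c) sequentially"
      by (rule order_tendstoD) (use c in simp)
    thus ?thesis using eventually_gt_at_top[of 0]
    proof eventually_elim
      case (elim n)
      have "ln (p n) \<le> ln (F (\<tau> n) * exp (\<tau> n * real n))"
        using coeff_le[OF \<tau>_pos[OF elim(2)]] coeff_pos[of n] by (subst ln_le_cancel_iff) (auto intro: less_le_trans)
      also have "\<dots> = ln (F (\<tau> n)) + y n"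
        using F_pos[OF \<tau>_pos[OF elim(2)]] n\<tau>[OF elim(2)] by (simp add: ln_mult)
      finally have "ln (p n) / y n \<le> ln (F (\<tau> n)) / y n + 1"
        using y_pos[OF elim(2)] by (simp add: field_simps)
      thus ?case using elim by simp
    qed
  qed
  have lower: "eventually (\<lambda>n. c < ln (p n) / y n) sequentially" if c: "c < 1 + 1 / \<alpha>" for c
  proof -
    \<comment> \<open>The expression is the lower bound that a parameter u > 1 will give. It tends
      to 1/\<alpha> + 1 as u decreases to 1, so some fixed u already beats c.\<close>
    have "((\<lambda>u. u powr (-\<alpha>) / \<alpha> + u * (2 * u - 1) powr (-(1 + \<alpha>)))
            \<longlongrightarrow> 1 powr (-\<alpha>) / \<alpha> + 1 * (2 * 1 - 1) powr (-(1 + \<alpha>))) (at_right 1)"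
      using assms by (intro tendsto_intros) auto
    hence "eventually (\<lambda>u. c < u powr (-\<alpha>) / \<alpha> + u * (2 * u - 1) powr (-(1 + \<alpha>))) (at_right 1)"
      by (rule order_tendstoD) (use c in simp)
    hence "eventually (\<lambda>u. c < u powr (-\<alpha>) / \<alpha> + u * (2 * u - 1) powr (-(1 + \<alpha>)) \<and> 1 < u) (at_right 1)"
      by (intro eventually_conj eventually_at_right_less)
    then obtain u where u: "1 < u" and cu: "c < u powr (-\<alpha>) / \<alpha> + u * (2 * u - 1) powr (-(1 + \<alpha>))"
      using eventually_happens[of _ "at_right (1::real)"] trivial_limit_at_right_real[of "1::real"] by blast
    \<comment> \<open>The mass of \<open>F (u * \<tau> n)\<close> sits near the index u^(-(1 +
      \<alpha>)) n, where the factor is minus the derivative of u^(-\<alpha>) / \<alpha>. As 1 < u <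
      b, this index lies strictly between v n and n, the corresponding indices for b and 1. The
      choice of b mirrors 1 at u, so that b tends to 1 with u.\<close>
    define b where "b = 2 * u - 1"
    define v where "v = b powr (-(1 + \<alpha>))"
    have b: "u < b" "0 < b" using u by (auto simp: b_def)
    \<comment> \<open>The tangent of u^(-\<alpha>) / \<alpha> at 1, evaluated at u; this controls
      the indices above n.\<close>
    have peak_right: "1 powr (-\<alpha>) / \<alpha> - (u - 1) < u powr (-\<alpha>) / \<alpha>"
      using divide_strict_right_mono[OF powr_minus_gt_tangent[of u \<alpha>], of \<alpha>] u assms
      by (simp add: diff_divide_distrib)
    \<comment> \<open>The tangent at b, of slope -v, evaluated at u; this controls the indices below
      v n. It is the tangent inequality for r = u / b, scaled by b^(-\<alpha>).\<close>
    have peak_left: "b powr (-\<alpha>) / \<alpha> + (b - u) * v < u powr (-\<alpha>) / \<alpha>"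
    proof -
      have "1 - \<alpha> * (u / b - 1) < (u / b) powr (-\<alpha>)"
        using b u assms by (intro powr_minus_gt_tangent) auto
      hence "b powr (-\<alpha>) * (1 - \<alpha> * (u / b - 1)) < b powr (-\<alpha>) * (u / b) powr (-\<alpha>)"
        using b by simp
      also have "\<dots> = u powr (-\<alpha>)" using b u by (simp flip: powr_mult)
      finally have 1: "b powr (-\<alpha>) * (1 - \<alpha> * (u / b - 1)) < u powr (-\<alpha>)" .
      have v: "b powr (-\<alpha>) = v * b"
      proof -
        have "v * b powr 1 = b powr (-\<alpha>)" unfolding v_def powr_add[symmetric] by simp
        thus ?thesis using b by simp
      qed
      have "v * b * (1 - \<alpha> * (u / b - 1)) = v * b + \<alpha> * ((b - u) * v)"
        using b by (simp add: field_simps)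
      with 1 v have "v * b + \<alpha> * ((b - u) * v) < u powr (-\<alpha>)" by simp
      hence "(v * b + \<alpha> * ((b - u) * v)) / \<alpha> < u powr (-\<alpha>) / \<alpha>"
        using assms by (intro divide_strict_right_mono)
      thus ?thesis using v assms by (simp add: add_divide_distrib)
    qed
    have e1: "eventually (\<lambda>n. exp (ln (F (1 * \<tau> n)) - (u - 1) * y n) \<le> exp (ln (F (u * \<tau> n))) / 4) sequentially"
    proof (rule eventually_exp_le_quarter[OF _ A peak_right y_lim])
      have "(\<lambda>n. ln (F (1 * \<tau> n)) / y n - (u - 1)) \<longlonglongrightarrow> 1 powr (-\<alpha>) / \<alpha> - (u - 1)"
        by (intro tendsto_diff tendsto_const A) simp
      thus "(\<lambda>n. (ln (F (1 * \<tau> n)) - (u - 1) * y n) / y n) \<longlonglongrightarrow> 1 powr (-\<alpha>) / \<alpha> - (u - 1)"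
        by (rule Lim_transform_eventually[OF _ eventually_mono[OF eventually_gt_at_top[of 0]]])
           (use y_pos in \<open>simp add: diff_divide_distrib less_imp_neq[symmetric]\<close>)
    qed (use u in simp)
    have e2: "eventually (\<lambda>n. exp (ln (F (b * \<tau> n)) + (b - u) * v * y n) \<le> exp (ln (F (u * \<tau> n))) / 4) sequentially"
    proof (rule eventually_exp_le_quarter[OF _ A peak_left y_lim])
      have "(\<lambda>n. ln (F (b * \<tau> n)) / y n + (b - u) * v) \<longlonglongrightarrow> b powr (-\<alpha>) / \<alpha> + (b - u) * v"
        by (intro tendsto_add tendsto_const A b)
      thus "(\<lambda>n. (ln (F (b * \<tau> n)) + (b - u) * v * y n) / y n) \<longlonglongrightarrow> b powr (-\<alpha>) / \<alpha> + (b - u) * v"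
        by (rule Lim_transform_eventually[OF _ eventually_mono[OF eventually_gt_at_top[of 0]]])
           (use y_pos in \<open>simp add: add_divide_distrib less_imp_neq[symmetric]\<close>)
    qed (use u in simp)
    \<comment> \<open>The subtracted terms come from the constant 4 and from the number of indices
      up to n; both vanish relative to \<open>y n\<close>.\<close>
    have "(\<lambda>n. ln (F (u * \<tau> n)) / y n + u * v - (ln 4 / y n + ln (real n) / real n powr \<beta> / K))
            \<longlonglongrightarrow> u powr (-\<alpha>) / \<alpha> + u * v - (0 + 0 / K)"
      using u \<beta> K by (intro tendsto_intros A lim_ln_over_power real_tendsto_divide_at_top[OF tendsto_const y_lim]) auto
    hence "eventually (\<lambda>n. c < ln (F (u * \<tau> n)) / y n + u * v - (ln 4 / y n + ln (real n) / real n powr \<beta> / K)) sequentially"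
      by (rule order_tendstoD) (use cu in \<open>simp add: v_def b_def\<close>)
    thus ?thesis using e1 e2 eventually_gt_at_top[of 0]
    proof eventually_elim
      case (elim n)
      note n = \<open>0 < n\<close>
      have pos: "0 < F (u * \<tau> n)" "0 < F (\<tau> n)" "0 < F (b * \<tau> n)"
        using u b \<tau>_pos[OF n] by (auto intro!: F_pos)
      have exp_ln_diff: "exp (ln x - z) = x * exp (- z)" if "0 < x" for x z :: real
        using that by (simp add: exp_diff exp_minus divide_inverse)
      have "F (u * \<tau> n) \<le> F (\<tau> n) * exp (- ((u * \<tau> n - \<tau> n) * real n))
          + F (b * \<tau> n) * exp ((b * \<tau> n - u * \<tau> n) * (v * real n))
          + (real n + 1) * (p n * exp (- (u * \<tau> n * (v * real n))))"
        using u b \<tau>_pos[OF n] by (intro F_le_split) auto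
      also have "(u * \<tau> n - \<tau> n) * real n = (u - 1) * y n"
        using n\<tau>[OF n] by (simp flip: n\<tau>[OF n] add: algebra_simps)
      also have "(b * \<tau> n - u * \<tau> n) * (v * real n) = (b - u) * v * y n"
        by (simp flip: n\<tau>[OF n] add: algebra_simps)
      also have "u * \<tau> n * (v * real n) = u * v * y n"
        by (simp flip: n\<tau>[OF n] add: algebra_simps)
      also have "F (\<tau> n) * exp (- ((u - 1) * y n)) \<le> F (u * \<tau> n) / 4"
        using elim(2) pos by (simp add: exp_ln_diff)
      also have "F (b * \<tau> n) * exp ((b - u) * v * y n) \<le> F (u * \<tau> n) / 4"
        using elim(3) pos by (simp add: exp_add)
      \<comment> \<open>The two errors take at most half of the left side, so the middle range
        carries the other half.\<close>
      finally have "F (u * \<tau> n) \<le> 2 * (real n + 1) * (p n * exp (- (u * v * y n)))"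
        by (simp add: field_simps)
      also have "\<dots> \<le> 4 * real n * (p n * exp (- (u * v * y n)))"
        using n coeff_pos[of n] by (intro mult_right_mono) auto
      finally have "ln (F (u * \<tau> n)) \<le> ln (4 * real n * (p n * exp (- (u * v * y n))))"
        using pos by (subst ln_le_cancel_iff) (auto intro: less_le_trans)
      also have "\<dots> = ln 4 + ln (real n) + ln (p n) - u * v * y n"
        using n coeff_pos[of n] by (simp add: ln_mult)
      finally have "ln (F (u * \<tau> n)) / y n \<le> (ln 4 + ln (real n) + ln (p n) - u * v * y n) / y n"
        using y_pos[OF n] by (simp add: divide_right_mono)
      also have "\<dots> = ln 4 / y n + ln (real n) / y n + ln (p n) / y n - u * v"
        using y_pos[OF n] by (simp add: add_divide_distrib diff_divide_distrib)
      also have "ln (real n) / y n = ln (real n) / real n powr \<beta> / K"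
        by (simp add: y_def)
      finally show ?case using elim(1) by linarith
    qed
  qed
  have "(\<lambda>n. ln (p n) / y n) \<longlonglongrightarrow> 1 + 1 / \<alpha>"
    using upper lower by (auto intro: order_tendstoI)
  hence "(\<lambda>n. ln (p n) / y n * K) \<longlonglongrightarrow> (1 + 1 / \<alpha>) * K"
    by (intro tendsto_mult tendsto_const)
  thus ?thesis using K by (simp add: y_def K_def \<beta>_def)
qed

end

subsection \<open>The generating function of partitions\<close>

text \<open>Bounding the parts by K keeps the first K factors of the product for the generating
  function, which can then be built by induction on K.\<close>

definition parts_bounded :: "(nat \<Rightarrow> nat) \<Rightarrow> nat \<Rightarrow> nat \<Rightarrow> nat list set" where
  "parts_bounded \<sigma> K n = {as. sorted as \<and> (\<forall>a\<in>set as. 0 < a \<and> a \<le> K) \<and> (\<Sum>a\<leftarrow>as. \<sigma> a) = n}"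

lemma length_le_sum_list_map:
  fixes \<sigma> :: "'a \<Rightarrow> nat"
  assumes "\<And>a. a \<in> set as \<Longrightarrow> 0 < \<sigma> a"
  shows "length as \<le> (\<Sum>a\<leftarrow>as. \<sigma> a)"
proof -
  have "(\<Sum>a\<leftarrow>as. 1) \<le> (\<Sum>a\<leftarrow>as. \<sigma> a)"
    using assms by (intro sum_list_mono) (simp add: Suc_leI)
  thus ?thesis by (simp add: sum_list_triv)
qed

lemma finite_parts_bounded:
  assumes "\<forall>a>0. 0 < \<sigma> a"
  shows "finite (parts_bounded \<sigma> K n)"
proof (rule finite_subset)
  show "parts_bounded \<sigma> K n \<subseteq> {as. set as \<subseteq> {0<..K} \<and> length as \<le> n}"
    using length_le_sum_list_map[of _ \<sigma>] assms by (fastforce simp: parts_bounded_def)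
  show "finite {as. set as \<subseteq> {0<..K} \<and> length as \<le> n}"
    by (rule finite_lists_length_le) simp
qed

lemma parts_bounded_0: "parts_bounded \<sigma> 0 n = (if n = 0 then {[]} else {})"
proof -
  have *: "(\<forall>a\<in>set as. 0 < a \<and> a \<le> 0) \<longleftrightarrow> as = []" for as :: "nat list" by (cases as) auto
  show ?thesis unfolding parts_bounded_def * by auto
qed

text \<open>Split by whether the part K + 1 occurs. If it does, sortedness puts it last. Removing
  one copy leaves a list that may still contain K + 1, hence the recursion in n at the same level
  \<open>Suc K\<close>.\<close>

lemma parts_bounded_Suc:
  "parts_bounded \<sigma> (Suc K) n = parts_bounded \<sigma> K n \<union>
     (if \<sigma> (Suc K) \<le> n then (\<lambda>as. as @ [Suc K]) ` parts_bounded \<sigma> (Suc K) (n - \<sigma> (Suc K)) else {})"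
  (is "?L = ?A \<union> ?B")
proof (intro equalityI subsetI)
  fix as assume as: "as \<in> ?L"
  show "as \<in> ?A \<union> ?B"
  proof (cases "Suc K \<in> set as")
    case False
    have "a \<le> K" if "a \<in> set as" for a
    proof -
      have "a \<le> Suc K" using as that by (auto simp: parts_bounded_def)
      moreover have "a \<noteq> Suc K" using False that by blast
      ultimately show ?thesis by simp
    qed
    thus ?thesis using as by (auto simp: parts_bounded_def)
  next
    case True
    then obtain bs b where bs: "as = bs @ [b]" by (cases as rule: rev_cases) auto
    have "Suc K \<le> b" "b \<le> Suc K"
      using True as unfolding bs by (auto simp: parts_bounded_def sorted_append)
    hence "b = Suc K" by simp
    thus ?thesis using as bs by (auto simp: parts_bounded_def sorted_append)
  qed
next
  fix as assume "as \<in> ?A \<union> ?B"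
  thus "as \<in> ?L"
    by (auto simp: parts_bounded_def sorted_append split: if_splits)
qed

lemma card_parts_bounded_Suc:
  assumes "\<forall>a>0. 0 < \<sigma> a"
  shows "card (parts_bounded \<sigma> (Suc K) n) = card (parts_bounded \<sigma> K n)
           + (if \<sigma> (Suc K) \<le> n then card (parts_bounded \<sigma> (Suc K) (n - \<sigma> (Suc K))) else 0)"
proof -
  let ?A = "parts_bounded \<sigma> K n"
    and ?B = "(\<lambda>as. as @ [Suc K]) ` parts_bounded \<sigma> (Suc K) (n - \<sigma> (Suc K))"
  have "card (?A \<union> ?B) = card ?A + card ?B"
  proof (rule card_Un_disjoint)
    have "Suc K \<notin> set as" if "as \<in> ?A" for as
      using that by (force simp only: parts_bounded_def mem_Collect_eq Suc_n_not_le_n)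
    moreover have "Suc K \<in> set as" if "as \<in> ?B" for as
      using that by fastforce
    ultimately show "?A \<inter> ?B = {}" by blast
  qed (simp_all add: finite_parts_bounded[OF assms])
  also have "card ?B = card (parts_bounded \<sigma> (Suc K) (n - \<sigma> (Suc K)))"
    by (rule card_image) (simp add: inj_on_def)
  finally show ?thesis by (subst parts_bounded_Suc) simp
qed

text \<open>Multiplication by the factor 1 / (1 - r) without a Cauchy product. Summing the recursion
  gives B = A + r B; the same computation on partial sums bounds them by A / (1 - r), which gives
  convergence.\<close>

lemma sums_of_shift_recursion:
  fixes a b :: "nat \<Rightarrow> real"
  assumes rec: "\<And>n. b n = a n + (if s \<le> n then r * b (n - s) else 0)"
    and a: "a sums A" and nn: "\<And>n. 0 \<le> a n" "\<And>n. 0 \<le> b n" and r: "0 \<le> r" "r < 1"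
  shows "b sums (A / (1 - r))"
proof -
  have shift: "(\<Sum>n<N. if s \<le> n then r * b (n - s) else 0) \<le> r * (\<Sum>n<N. b n)" for N
  proof -
    have "(\<Sum>n<N. if s \<le> n then r * b (n - s) else 0) = (\<Sum>n\<in>{s..<N}. r * b (n - s))"
      by (rule sum.mono_neutral_cong_right) auto
    also have "\<dots> = (\<Sum>n<N-s. r * b n)"
      by (rule sum.reindex_bij_witness[of _ "\<lambda>n. n + s" "\<lambda>n. n - s"]) auto
    also have "\<dots> \<le> (\<Sum>n<N. r * b n)"
      using r nn by (intro sum_mono2) auto
    finally show ?thesis by (simp add: sum_distrib_left)
  qed
  have bound: "(\<Sum>n<N. b n) \<le> A / (1 - r)" for N
  proof -
    have "(\<Sum>n<N. b n) = (\<Sum>n<N. a n) + (\<Sum>n<N. if s \<le> n then r * b (n - s) else 0)"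
      by (subst rec) (rule sum.distrib)
    also have "\<dots> \<le> A + r * (\<Sum>n<N. b n)"
      using sum_le_suminf[OF sums_summable[OF a], of "{..<N}"] sums_unique[OF a] nn shift
      by (intro add_mono) auto
    finally show ?thesis using r by (simp add: field_simps)
  qed
  have sb: "summable b" by (rule summableI_nonneg_bounded[OF nn(2) bound])
  have "(\<lambda>n. if s \<le> n then r * b (n - s) else 0) sums (r * suminf b)"
    by (subst sums_iff_shift'[of _ s, symmetric])
       (use sums_mult[OF summable_sums[OF sb]] in simp_all)
  hence "(\<lambda>n. a n + (if s \<le> n then r * b (n - s) else 0)) sums (A + r * suminf b)"
    by (intro sums_add a)
  hence b: "b sums (A + r * suminf b)" by (rule sums_cong[OF rec, THEN iffD2])
  hence "suminf b * (1 - r) = A" using sums_unique[OF b] by (simp add: algebra_simps)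
  hence "suminf b = A / (1 - r)" using r by (simp add: nonzero_eq_divide_eq)
  thus ?thesis using summable_sums[OF sb] by simp
qed

text \<open>The finite product is written as the exponential of a sum of logarithms, so that letting
  K grow only requires convergence of a series.\<close>

lemma sums_card_parts_bounded:
  assumes pos: "\<forall>a>0. 0 < \<sigma> a" and t: "0 < t"
  shows "(\<lambda>n. real (card (parts_bounded \<sigma> K n)) * exp (- (t * real n)))
           sums exp (\<Sum>i<K. - ln (1 - exp (- (t * real (\<sigma> (Suc i))))))"
proof (induction K)
  case 0
  show ?case
  proof (rule sums_cong[THEN iffD1])
    show "(\<lambda>n. if n = 0 then exp (- (t * real n)) else 0)
            sums exp (\<Sum>i<0. - ln (1 - exp (- (t * real (\<sigma> (Suc i))))))"
      using sums_single[of 0 "\<lambda>n. exp (- (t * real n))"] by simp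
  qed (auto simp: parts_bounded_0)
next
  case (Suc K)
  let ?s = "\<sigma> (Suc K)"
  let ?r = "exp (- (t * real ?s))"
  have r: "?r < 1" using pos t by simp
  have "(\<lambda>n. real (card (parts_bounded \<sigma> (Suc K) n)) * exp (- (t * real n)))
      sums (exp (\<Sum>i<K. - ln (1 - exp (- (t * real (\<sigma> (Suc i)))))) / (1 - ?r))"
  proof (rule sums_of_shift_recursion[OF _ Suc.IH])
    fix n
    show "real (card (parts_bounded \<sigma> (Suc K) n)) * exp (- (t * real n)) =
        real (card (parts_bounded \<sigma> K n)) * exp (- (t * real n)) +
        (if ?s \<le> n then ?r * (real (card (parts_bounded \<sigma> (Suc K) (n - ?s))) * exp (- (t * real (n - ?s)))) else 0)"
    proof (cases "?s \<le> n")
      case True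
      hence "?r * exp (- (t * real (n - ?s))) = exp (- (t * real n))"
        by (simp add: of_nat_diff algebra_simps flip: exp_add)
      with True show ?thesis
        by (subst card_parts_bounded_Suc[OF pos]) (simp_all add: distrib_right mult.left_commute)
    qed (subst card_parts_bounded_Suc[OF pos], simp_all)
  qed (use r in auto)
  also have "exp (\<Sum>i<K. - ln (1 - exp (- (t * real (\<sigma> (Suc i)))))) / (1 - ?r)
      = exp (\<Sum>i<Suc K. - ln (1 - exp (- (t * real (\<sigma> (Suc i))))))"
    using r by (simp add: exp_diff exp_minus)
  finally show ?case .
qed

section \<open>From bounded parts to all partitions\<close>

lemma p_sigma_eq_card_parts_bounded:
  assumes "\<And>a. 0 < a \<Longrightarrow> \<sigma> a \<le> n \<Longrightarrow> a \<le> K"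
  shows "p_sigma \<sigma> n = card (parts_bounded \<sigma> K n)"
proof -
  have "\<sigma> a \<le> (\<Sum>a\<leftarrow>as. \<sigma> a)" if "a \<in> set as" for a as
    using that by (intro member_le_sum_list) auto
  hence "{as. sorted as \<and> (\<forall>a\<in>set as. 0 < a) \<and> (\<Sum>a\<leftarrow>as. \<sigma> a) = n} = parts_bounded \<sigma> K n"
    using assms by (force simp: parts_bounded_def)
  thus ?thesis by (simp add: p_sigma_def)
qed

text \<open>One truncation level that is harmless for all totals up to n at once; \<open>K0\<close>
  lets it also exceed a prescribed level.\<close>

lemma parts_bound_exists:
  fixes \<sigma> :: "nat \<Rightarrow> nat"
  assumes "finite {a. \<sigma> a \<le> n}"
  obtains K where "K0 \<le> K" "\<And>a m. m \<le> n \<Longrightarrow> \<sigma> a \<le> m \<Longrightarrow> a \<le> K"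
proof
  show "K0 \<le> Max (insert K0 {a. \<sigma> a \<le> n})" using assms by simp
  show "a \<le> Max (insert K0 {a. \<sigma> a \<le> n})" if "m \<le> n" "\<sigma> a \<le> m" for a m
    using assms that by (intro Max_ge) auto
qed

text \<open>Prepending the part 1 is injective, keeps the list sorted because all parts are
  positive, and raises the total by \<open>\<sigma> 1 = 1\<close>.\<close>

lemma p_sigma_Suc_ge:
  assumes pos: "\<forall>a>0. 0 < \<sigma> a" and fin: "\<And>n. finite {a. \<sigma> a \<le> n}" and "\<sigma> 1 = 1"
  shows "p_sigma \<sigma> n \<le> p_sigma \<sigma> (Suc n)"
proof -
  obtain K where K: "1 \<le> K" "\<And>a m. m \<le> Suc n \<Longrightarrow> \<sigma> a \<le> m \<Longrightarrow> a \<le> K"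
    by (rule parts_bound_exists[OF fin]) blast
  have "card (parts_bounded \<sigma> K n) \<le> card (parts_bounded \<sigma> K (Suc n))"
  proof (rule card_inj_on_le[of "Cons 1"])
    show "Cons 1 ` parts_bounded \<sigma> K n \<subseteq> parts_bounded \<sigma> K (Suc n)"
      using K(1) assms(3) by (auto simp: parts_bounded_def Suc_le_eq)
  qed (simp_all add: finite_parts_bounded[OF pos])
  thus ?thesis
    using p_sigma_eq_card_parts_bounded[of \<sigma> _ K] K(2)[of n] K(2)[of "Suc n"] by simp
qed

lemma p_sigma_0_pos:
  assumes pos: "\<forall>a>0. 0 < \<sigma> a" and fin: "\<And>n. finite {a. \<sigma> a \<le> n}"
  shows "0 < p_sigma \<sigma> 0"
proof -
  obtain K where K: "0 \<le> K" "\<And>a m. m \<le> 0 \<Longrightarrow> \<sigma> a \<le> m \<Longrightarrow> a \<le> K"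
    by (rule parts_bound_exists[OF fin]) blast
  have "[] \<in> parts_bounded \<sigma> K 0" by (simp add: parts_bounded_def)
  hence "0 < card (parts_bounded \<sigma> K 0)"
    using finite_parts_bounded[OF pos] by (auto simp: card_gt_0_iff)
  thus ?thesis using p_sigma_eq_card_parts_bounded[of \<sigma> 0 K] K(2) by simp
qed

text \<open>Two inequalities. A partial sum of the series involves only totals below N and so agrees
  with a truncated count for large K, which gives at most \<open>exp S\<close>. Conversely,
  truncated counts are termwise at most the full ones, and K tends to infinity.\<close>

lemma sums_p_sigma:
  assumes pos: "\<forall>a>0. 0 < \<sigma> a" and fin: "\<And>n. finite {a. \<sigma> a \<le> n}" and t: "0 < t"
    and S: "(\<lambda>i. - ln (1 - exp (- (t * real (\<sigma> (Suc i)))))) sums S"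
  shows "(\<lambda>n. real (p_sigma \<sigma> n) * exp (- (t * real n))) sums exp S"
proof -
  let ?L = "\<lambda>i. - ln (1 - exp (- (t * real (\<sigma> (Suc i)))))"
  let ?f = "\<lambda>n. real (p_sigma \<sigma> n) * exp (- (t * real n))"
  let ?g = "\<lambda>K n. real (card (parts_bounded \<sigma> K n)) * exp (- (t * real n))"
  note g = sums_card_parts_bounded[of \<sigma>, OF pos t]
  have L: "0 \<le> ?L i" for i using pos t by simp
  have bound: "(\<Sum>n<N. ?f n) \<le> exp S" for N
  proof -
    obtain K where K: "0 \<le> K" "\<And>a m. m \<le> N \<Longrightarrow> \<sigma> a \<le> m \<Longrightarrow> a \<le> K"
      by (rule parts_bound_exists[OF fin]) blast
    have "(\<Sum>n<N. ?f n) = (\<Sum>n<N. ?g K n)"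
    proof (intro sum.cong refl)
      fix n assume "n \<in> {..<N}"
      hence "p_sigma \<sigma> n = card (parts_bounded \<sigma> K n)"
        using K(2)[of n] by (intro p_sigma_eq_card_parts_bounded) simp
      thus "?f n = ?g K n" by simp
    qed
    also have "\<dots> \<le> suminf (?g K)"
      by (intro sum_le_suminf sums_summable[OF g]) auto
    also have "\<dots> = exp (\<Sum>i<K. ?L i)" using sums_unique[OF g] by simp
    also have "\<dots> \<le> exp S"
      using sum_le_suminf[OF sums_summable[OF S], of "{..<K}"] sums_unique[OF S] L by simp
    finally show ?thesis .
  qed
  have f: "summable ?f" by (rule summableI_nonneg_bounded[OF _ bound]) simp
  have "exp (\<Sum>i<K. ?L i) \<le> suminf ?f" for K
  proof (rule sums_le[OF _ g summable_sums[OF f]])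
    fix n
    obtain K' where K': "K \<le> K'" "\<And>a m. m \<le> n \<Longrightarrow> \<sigma> a \<le> m \<Longrightarrow> a \<le> K'"
      by (rule parts_bound_exists[OF fin]) blast
    have "card (parts_bounded \<sigma> K n) \<le> card (parts_bounded \<sigma> K' n)"
      using K'(1) by (intro card_mono finite_parts_bounded pos) (auto simp: parts_bounded_def)
    also have "\<dots> = p_sigma \<sigma> n"
      using K'(2) by (intro p_sigma_eq_card_parts_bounded[symmetric]) auto
    finally show "?g K n \<le> ?f n" by simp
  qed
  hence "exp S \<le> suminf ?f"
    using S by (intro LIMSEQ_le_const2[OF tendsto_exp]) (auto simp: sums_def)
  moreover have "suminf ?f \<le> exp S" by (rule suminf_le_const[OF f bound])
  ultimately show ?thesis using f by (simp add: sums_iff)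
qed

subsection \<open>Sums of exponentials\<close>

text \<open>Substitute t = s x^d in Euler's integral for \<Gamma>(1/d), then use \<Gamma>(1 + 1/d) =
  \<Gamma>(1/d) / d.\<close>

lemma has_integral_exp_minus_powr:
  fixes s d :: real
  assumes "s > 0" "d > 0"
  shows "((\<lambda>x. exp (- (s * x powr d))) has_integral (Gamma (1 + 1 / d) * s powr (- (1 / d)))) {0..}"
proof -
  define \<alpha> where "\<alpha> = 1 / d"
  have \<alpha>: "\<alpha> > 0" "d * \<alpha> = 1" using assms by (auto simp: \<alpha>_def)
  let ?f = "\<lambda>t. t powr (\<alpha> - 1) / exp t"
  let ?g = "\<lambda>x. s * x powr d"
  let ?g' = "\<lambda>x. s * (d * x powr (d - 1))"
  let ?h = "\<lambda>x. exp (- (s * x powr d))"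
  have image: "?g ` {0<..} = {0<..}"
  proof (intro equalityI subsetI)
    fix y :: real assume y: "y \<in> {0<..}"
    have "y = ?g ((y / s) powr \<alpha>)" using y assms \<alpha> by (simp add: powr_powr mult.commute[of \<alpha> d])
    moreover have "(y / s) powr \<alpha> \<in> {0<..}" using y assms by simp
    ultimately show "y \<in> ?g ` {0<..}" by (rule image_eqI)
  qed (use assms in auto)
  have inj: "inj_on ?g {0<..}"
  proof (rule inj_onI)
    fix x y :: real assume xy: "x \<in> {0<..}" "y \<in> {0<..}" "?g x = ?g y"
    hence "(x powr d) powr \<alpha> = (y powr d) powr \<alpha>" using assms by simp
    thus "x = y" using xy \<alpha> by (simp add: powr_powr)
  qed
  \<comment> \<open>The null set {0} is removed because x^d need not be differentiable there when d
    < 1.\<close>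
  have "((\<lambda>t. if t \<in> {0<..} then ?f t else 0) has_integral Gamma \<alpha>) {0..}"
    by (rule has_integral_spike[of "{0}", OF _ _ Gamma_integral_real[OF \<alpha>(1)]]) auto
  hence f: "(?f has_integral Gamma \<alpha>) {0<..}"
    by (subst (asm) has_integral_restrict) auto
  hence "?f absolutely_integrable_on {0<..}"
    by (intro nonnegative_absolutely_integrable_1) auto
  moreover have "(?g has_field_derivative ?g' x) (at x within {0<..})" if "x \<in> {0<..}" for x
    using that by (auto intro!: derivative_eq_intros)
  ultimately have "(\<lambda>x. \<bar>?g' x\<bar> * ?f (?g x)) absolutely_integrable_on {0<..} \<and>
      integral {0<..} (\<lambda>x. \<bar>?g' x\<bar> * ?f (?g x)) = Gamma \<alpha>"
    using has_absolute_integral_change_of_variables_1'[of "{0<..}" ?g ?g' ?f "Gamma \<alpha>"]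
      inj image integral_unique[OF f] by simp
  hence "((\<lambda>x. \<bar>?g' x\<bar> * ?f (?g x)) has_integral Gamma \<alpha>) {0<..}"
    unfolding has_integral_integrable_integral using set_lebesgue_integral_eq_integral(1) by blast
  moreover have "\<bar>?g' x\<bar> * ?f (?g x) = d * s powr \<alpha> * ?h x" if "x \<in> {0<..}" for x
  proof -
    have "x powr (d - 1) * (x powr d) powr (\<alpha> - 1) = x powr ((d - 1) + d * (\<alpha> - 1))"
      by (simp only: powr_powr powr_add)
    also have "(d - 1) + d * (\<alpha> - 1) = 0" using \<alpha> by (simp add: algebra_simps)
    finally have 1: "x powr (d - 1) * (x powr d) powr (\<alpha> - 1) = 1" using that by simp
    have "s powr 1 * s powr (\<alpha> - 1) = s powr \<alpha>" unfolding powr_add[symmetric] by simp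
    hence 2: "s * s powr (\<alpha> - 1) = s powr \<alpha>" using assms by simp
    have "\<bar>?g' x\<bar> * ?f (?g x)
        = d * (s * s powr (\<alpha> - 1)) * (x powr (d - 1) * (x powr d) powr (\<alpha> - 1)) * ?h x"
      using assms by (simp add: powr_mult exp_minus divide_inverse)
    thus ?thesis unfolding 1 2 by simp
  qed
  ultimately have "((\<lambda>x. d * s powr \<alpha> * ?h x) has_integral Gamma \<alpha>) {0<..}"
    by (rule has_integral_eq[rotated])
  hence "((\<lambda>x. (\<alpha> * s powr (-\<alpha>)) * (d * s powr \<alpha> * ?h x))
            has_integral (\<alpha> * s powr (-\<alpha>) * Gamma \<alpha>)) {0<..}"
    by (rule has_integral_mult_right)
  moreover have "\<alpha> * s powr (-\<alpha>) * (d * s powr \<alpha> * z) = z" for z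
    using assms by (simp add: powr_minus \<alpha>_def)
  ultimately have "(?h has_integral (\<alpha> * s powr (-\<alpha>) * Gamma \<alpha>)) {0<..}" by simp
  hence "((\<lambda>x. if x \<in> {0<..} then ?h x else 0) has_integral (\<alpha> * s powr (-\<alpha>) * Gamma \<alpha>)) {0..}"
    by (subst has_integral_restrict) auto
  hence "(?h has_integral (\<alpha> * s powr (-\<alpha>) * Gamma \<alpha>)) {0..}"
    by (rule has_integral_spike[of "{0}", rotated 2]) auto
  moreover have G: "Gamma (1 + \<alpha>) = \<alpha> * Gamma \<alpha>"
  proof -
    have "\<alpha> \<notin> \<int>\<^sub>\<le>\<^sub>0" using \<alpha>(1) nonpos_Ints_nonpos[of \<alpha>] by linarith
    from Gamma_plus1[OF this] show ?thesis by (simp add: add.commute)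
  qed
  ultimately show ?thesis unfolding \<alpha>_def[symmetric] G by (simp only: mult_ac)
qed

text \<open>The error 1 is the value at 0 of the decreasing function \<open>x \<mapsto> exp (- s x\<^sup>d)\<close>.\<close>
lemma exp_minus_powr_sum_bounds:
  fixes s d :: real
  assumes "s > 0" "d > 0"
  defines "I \<equiv> Gamma (1 + 1 / d) * s powr (- (1 / d))"
  shows "summable (\<lambda>i. exp (- (s * real (Suc i) powr d)))"
    "(\<Sum>i. exp (- (s * real (Suc i) powr d))) \<le> I"
    "I - 1 \<le> (\<Sum>i. exp (- (s * real (Suc i) powr d)))"
proof -
  let ?f = "\<lambda>x. exp (- (s * x powr d))"
  have int: "(?f has_integral I) {0..}"
    unfolding I_def by (rule has_integral_exp_minus_powr[OF assms(1,2)])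
  interpret antimono_fun_sum_integral_diff ?f
  proof
    have "continuous_on {0..} (\<lambda>x::real. x powr d)"
      using assms(2) by (intro continuous_on_powr' continuous_on_id continuous_on_const) auto
    thus "continuous_on {0..} ?f" by (intro continuous_on_exp continuous_on_minus continuous_on_mult continuous_on_const)
  qed (use assms(1,2) in \<open>auto intro!: mult_left_mono powr_mono2\<close>)
  have int_n: "?f integrable_on {0..real n}" for n
    by (rule integrable_continuous_real[OF continuous_on_subset[OF cont]]) auto
  \<comment> \<open>The term k = 0 is 1, as \<open>0 powr d\<close> is 0.\<close>
  have sum_Suc: "(\<Sum>k\<le>n. ?f (real k)) = 1 + (\<Sum>i<n. ?f (real (Suc i)))" for n
    by (induction n) (use assms(2) in simp_all)
  have upper: "(\<Sum>i<n. ?f (real (Suc i))) \<le> I" for n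
  proof -
    have "(\<Sum>i<n. ?f (real (Suc i))) \<le> integral {0..real n} ?f"
      using sum_integral_diff_series_antimono[of 0 n] sum_Suc[of n] assms
      by (simp add: sum_integral_diff_series_def)
    also have "\<dots> \<le> integral {0..} ?f"
      using int by (intro integral_subset_le int_n) auto
    also have "\<dots> = I" using int by (rule integral_unique)
    finally show ?thesis .
  qed
  show summ: "summable (\<lambda>i. ?f (real (Suc i)))" by (rule summableI_nonneg_bounded[OF _ upper]) simp
  thus "(\<Sum>i. ?f (real (Suc i))) \<le> I" by (rule suminf_le_const[OF _ upper])
  show "I - 1 \<le> (\<Sum>i. ?f (real (Suc i)))"
  proof (rule field_le_epsilon)
    fix e :: real assume "e > 0"
    \<comment> \<open>The integral over the half-line is within e of one over a bounded interval, to
      which the finite comparison applies.\<close>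
    with int obtain B where B: "\<And>a b. ball 0 B \<subseteq> cbox a b \<Longrightarrow>
        norm (integral (cbox a b) (\<lambda>x. if x \<in> {0..} then ?f x else 0) - I) < e"
      unfolding has_integral_alt' by meson
    obtain n where n: "B \<le> real n" using real_arch_simple by blast
    have "ball 0 B \<subseteq> cbox (- real n) (real n)" using n by (auto simp: dist_real_def)
    hence "I - e < integral (cbox (- real n) (real n)) (\<lambda>x. if x \<in> {0..} then ?f x else 0)"
      using B by (fastforce simp: abs_less_iff)
    also have "\<dots> = integral ({0..} \<inter> cbox (- real n) (real n)) ?f"
      by (simp only: integral_restrict_Int Int_commute)
    also have "{0..} \<inter> cbox (- real n) (real n) = {0..real n}" by auto
    also have "integral {0..real n} ?f \<le> (\<Sum>k\<le>n. ?f (real k))"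
      using sum_integral_diff_series_nonneg[of n] by (simp add: sum_integral_diff_series_def)
    also have "\<dots> \<le> 1 + (\<Sum>i. ?f (real (Suc i)))"
      unfolding sum_Suc by (intro add_left_mono sum_le_suminf summ) auto
    finally show "I - 1 \<le> (\<Sum>i. ?f (real (Suc i))) + e" by simp
  qed
qed

text \<open>Tonelli for double series: nonnegativity turns \<open>sums\<close> into the
  unconditional \<open>has_sum\<close>, and the sum over pairs may be taken in either order.\<close>

lemma sums_swap_nonneg:
  fixes f :: "nat \<Rightarrow> nat \<Rightarrow> real"
  assumes nn: "\<And>i j. 0 \<le> f i j" and rows: "\<And>i. f i sums g i" and g: "g sums S"
    and cols: "\<And>j. (\<lambda>i. f i j) sums h j"
  shows "h sums S"
proof -
  have g_nn: "0 \<le> g i" for i using sums_le[OF _ sums_zero rows] nn by blast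
  have rows': "((\<lambda>j. case_prod f (i, j)) has_sum g i) UNIV" for i
    using sums_nonneg_imp_has_sum[OF rows nn] by simp
  have g': "(g has_sum S) UNIV" by (rule sums_nonneg_imp_has_sum[OF g g_nn])
  have "case_prod f summable_on UNIV \<times> UNIV"
    by (rule summable_on_SigmaI[OF rows']) (use g' nn in \<open>auto simp: summable_on_def\<close>)
  with rows' g' have "(case_prod f has_sum S) (UNIV \<times> UNIV)"
    by (intro has_sum_SigmaI)
  hence "((\<lambda>(j, i). f i j) has_sum S) (UNIV \<times> UNIV)"
    by (subst (asm) has_sum_swap) (simp add: case_prod_unfold)
  moreover have "((\<lambda>i. (\<lambda>(j, i). f i j) (j, i)) has_sum h j) UNIV" for j
    using sums_nonneg_imp_has_sum[OF cols nn] by simp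
  ultimately have "(h has_sum S) UNIV" by (rule has_sum_SigmaD)
  thus ?thesis by (rule has_sum_imp_sums)
qed

lemma powr_mult_powr_minus:
  fixes x y a :: real
  shows "0 < x \<Longrightarrow> x powr a * (y * x powr (- a)) = y"
  using mult.left_commute[of "x powr a" y "x powr (- a)"] by (simp flip: powr_add)

section \<open>The logarithm of the generating function near 0\<close>

context
  fixes d :: real
  assumes d: "d > 0"
begin

text \<open>The function E of the outline; \<open>Suc i\<close> runs through the parts a \<ge>
  1.\<close>

definition floor_powr_sum :: "real \<Rightarrow> real" where
  "floor_powr_sum s = (\<Sum>i. exp (- (s * real (nat \<lfloor>real (Suc i) powr d\<rfloor>))))"

lemma floor_powr_bounds:
  assumes "0 < a"
  shows "real (nat \<lfloor>real a powr d\<rfloor>) \<le> real a powr d" "real a powr d \<le> real (nat \<lfloor>real a powr d\<rfloor>) + 1"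
    "real a powr d \<le> 2 * real (nat \<lfloor>real a powr d\<rfloor>)" "1 \<le> nat \<lfloor>real a powr d\<rfloor>"
proof -
  have "1 \<le> real a powr d" using assms d by (intro ge_one_powr_ge_zero) auto
  hence f: "1 \<le> \<lfloor>real a powr d\<rfloor>" by (simp add: le_floor_iff)
  thus "1 \<le> nat \<lfloor>real a powr d\<rfloor>" by linarith
  have eq: "real (nat \<lfloor>real a powr d\<rfloor>) = real_of_int \<lfloor>real a powr d\<rfloor>" using f by simp
  show "real (nat \<lfloor>real a powr d\<rfloor>) \<le> real a powr d" unfolding eq by simp
  show 1: "real a powr d \<le> real (nat \<lfloor>real a powr d\<rfloor>) + 1" unfolding eq by linarith
  have "1 \<le> real (nat \<lfloor>real a powr d\<rfloor>)" unfolding eq using f by linarith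
  with 1 show "real a powr d \<le> 2 * real (nat \<lfloor>real a powr d\<rfloor>)" by linarith
qed

text \<open>Write y = a^d. Replacing the floor by y/2 costs 2^(1/d) for every s > 0, which serves as
  a majorant. Replacing it by y - 1 costs e^s, which is sharp as s tends to 0. Replacing it by y
  gives the lower bound.\<close>

lemma sums_floor_powr:
  assumes s: "s > 0"
  shows "(\<lambda>i. exp (- (s * real (nat \<lfloor>real (Suc i) powr d\<rfloor>)))) sums floor_powr_sum s"
    and "floor_powr_sum s \<le> 2 powr (1 / d) * Gamma (1 + 1 / d) * s powr (- (1 / d))"
    and "floor_powr_sum s \<le> exp s * Gamma (1 + 1 / d) * s powr (- (1 / d))"
    and "Gamma (1 + 1 / d) * s powr (- (1 / d)) - 1 \<le> floor_powr_sum s"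
proof -
  let ?e = "\<lambda>i. exp (- (s * real (nat \<lfloor>real (Suc i) powr d\<rfloor>)))"
  let ?I = "\<lambda>s. Gamma (1 + 1 / d) * s powr (- (1 / d))"
  have half: "?e i \<le> exp (- ((s / 2) * real (Suc i) powr d))" for i
    using floor_powr_bounds(3)[of "Suc i"] s by (simp add: field_simps)
  have s2: "0 < s / 2" using s by simp
  note B = exp_minus_powr_sum_bounds[OF s d] and B2 = exp_minus_powr_sum_bounds[OF s2 d]
  have summ: "summable ?e"
    by (rule summable_comparison_test'[OF B2(1), of 0]) (use half in simp)
  thus "?e sums floor_powr_sum s" unfolding floor_powr_sum_def by (rule summable_sums)
  have "floor_powr_sum s \<le> ?I (s / 2)"
    unfolding floor_powr_sum_def by (rule order.trans[OF suminf_le[OF half summ B2(1)] B2(2)])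
  also have "(s / 2) powr (- (1 / d)) = 2 powr (1 / d) * s powr (- (1 / d))"
    using s by (simp add: powr_divide powr_minus_divide)
  finally show "floor_powr_sum s \<le> 2 powr (1 / d) * Gamma (1 + 1 / d) * s powr (- (1 / d))"
    by (simp add: mult_ac)
  have "?e i \<le> exp s * exp (- (s * real (Suc i) powr d))" for i
  proof -
    have "s * real (Suc i) powr d \<le> s * (real (nat \<lfloor>real (Suc i) powr d\<rfloor>) + 1)"
      using floor_powr_bounds(2)[of "Suc i"] s by (intro mult_left_mono) auto
    thus ?thesis by (simp add: distrib_left flip: exp_add)
  qed
  hence "floor_powr_sum s \<le> (\<Sum>i. exp s * exp (- (s * real (Suc i) powr d)))"
    unfolding floor_powr_sum_def by (intro suminf_le summ summable_mult B(1))
  also have "\<dots> = exp s * (\<Sum>i. exp (- (s * real (Suc i) powr d)))" by (rule suminf_mult[OF B(1)])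
  also have "\<dots> \<le> exp s * ?I s" using B(2) by simp
  finally show "floor_powr_sum s \<le> exp s * Gamma (1 + 1 / d) * s powr (- (1 / d))" by (simp only: mult.assoc)
  have "(\<Sum>i. exp (- (s * real (Suc i) powr d))) \<le> floor_powr_sum s"
    unfolding floor_powr_sum_def
    by (intro suminf_le B(1) summ) (use floor_powr_bounds(1) s in simp)
  with B(3) show "?I s - 1 \<le> floor_powr_sum s" by simp
qed

lemma floor_powr_sum_nonneg: "s > 0 \<Longrightarrow> 0 \<le> floor_powr_sum s"
  using sums_le[OF _ sums_zero sums_floor_powr(1)] by force

lemma powr_mult_floor_powr_sum_le:
  assumes "s > 0"
  shows "s powr (1 / d) * floor_powr_sum s \<le> 2 powr (1 / d) * Gamma (1 + 1 / d)"
proof -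
  have "s powr (1 / d) * floor_powr_sum s
      \<le> s powr (1 / d) * (2 powr (1 / d) * Gamma (1 + 1 / d) * s powr (- (1 / d)))"
    using sums_floor_powr(2)[OF assms] by (rule mult_left_mono) simp
  thus ?thesis unfolding powr_mult_powr_minus[OF assms] .
qed

lemma tendsto_powr_mult_floor_powr_sum:
  "((\<lambda>s. s powr (1 / d) * floor_powr_sum s) \<longlongrightarrow> Gamma (1 + 1 / d)) (at_right 0)"
proof (rule tendsto_sandwich)
  have id: "((\<lambda>s. s :: real) \<longlongrightarrow> 0) (at_right 0)" by (simp add: tendsto_ident_at)
  have "((\<lambda>s. s powr (1 / d)) \<longlongrightarrow> 0) (at_right (0::real))"
    by (rule tendsto_zero_powrI[OF id tendsto_const]) (use d in \<open>auto simp: eventually_at_right_less eventually_at_filter\<close>)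
  from tendsto_diff[OF tendsto_const this]
  show "((\<lambda>s. Gamma (1 + 1 / d) - s powr (1 / d)) \<longlongrightarrow> Gamma (1 + 1 / d)) (at_right 0)" by simp
  show "((\<lambda>s. exp s * Gamma (1 + 1 / d)) \<longlongrightarrow> Gamma (1 + 1 / d)) (at_right 0)"
    using tendsto_mult[OF tendsto_exp[OF id] tendsto_const] by simp
  show "eventually (\<lambda>s. Gamma (1 + 1 / d) - s powr (1 / d) \<le> s powr (1 / d) * floor_powr_sum s) (at_right 0)"
    using eventually_at_right_less
  proof eventually_elim
    case (elim s)
    have "s powr (1 / d) * (Gamma (1 + 1 / d) * s powr (- (1 / d)) - 1) \<le> s powr (1 / d) * floor_powr_sum s"
      using sums_floor_powr(4)[OF elim] by (rule mult_left_mono) simp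
    thus ?case using powr_mult_powr_minus[OF elim] by (simp only: right_diff_distrib mult_1_right)
  qed
  show "eventually (\<lambda>s. s powr (1 / d) * floor_powr_sum s \<le> exp s * Gamma (1 + 1 / d)) (at_right 0)"
    using eventually_at_right_less
  proof eventually_elim
    case (elim s)
    have "s powr (1 / d) * floor_powr_sum s
        \<le> s powr (1 / d) * (exp s * Gamma (1 + 1 / d) * s powr (- (1 / d)))"
      using sums_floor_powr(3)[OF elim] by (rule mult_left_mono) simp
    thus ?case unfolding powr_mult_powr_minus[OF elim] .
  qed
qed

lemma summable_zeta_terms: "summable (\<lambda>k. real (Suc k) powr (- (1 + 1 / d)))"
  using summable_real_powr_iff[of "- (1 + 1 / d)"] d
    summable_Suc_iff[of "\<lambda>k. real k powr (- (1 + 1 / d))"] by simp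

text \<open>The uniform bound on E contributes k^(-1/d) and the division by k one more power, so the
  zeta series dominates.\<close>

lemma summable_floor_powr_sum_terms:
  assumes t: "t > 0"
  shows "summable (\<lambda>k. floor_powr_sum (t * real (Suc k)) / real (Suc k))"
proof (rule summable_comparison_test'[OF summable_mult[OF summable_zeta_terms], of 0])
  fix k
  let ?M = "2 powr (1 / d) * Gamma (1 + 1 / d)"
  have tk: "0 < t * real (Suc k)" using t by simp
  have "floor_powr_sum (t * real (Suc k)) / real (Suc k)
      \<le> ?M * (t * real (Suc k)) powr (- (1 / d)) / real (Suc k)"
    by (rule divide_right_mono[OF sums_floor_powr(2)[OF tk]]) simp
  also have "\<dots> = ?M * t powr (- (1 / d)) * (real (Suc k) powr (- (1 / d)) / real (Suc k) powr 1)"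
    using t by (simp add: powr_mult)
  also have "real (Suc k) powr (- (1 / d)) / real (Suc k) powr 1 = real (Suc k) powr (- (1 + 1 / d))"
    unfolding powr_diff[symmetric] by (rule arg_cong[of _ _ "(powr) _"]) simp
  finally show "norm (floor_powr_sum (t * real (Suc k)) / real (Suc k))
      \<le> ?M * t powr (- (1 / d)) * real (Suc k) powr (- (1 + 1 / d))"
    using floor_powr_sum_nonneg[OF tk] by simp
qed

lemma log_generating_function:
  assumes t: "t > 0"
  defines "S \<equiv> (\<Sum>k. floor_powr_sum (t * real (Suc k)) / real (Suc k))"
  shows "(\<lambda>i. - ln (1 - exp (- (t * real (nat \<lfloor>real (Suc i) powr d\<rfloor>))))) sums S"
proof (rule sums_swap_nonneg)
  let ?\<sigma> = "\<lambda>i. real (nat \<lfloor>real (Suc i) powr d\<rfloor>)"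
  let ?f = "\<lambda>k i. exp (- (t * real (Suc k) * ?\<sigma> i)) / real (Suc k)"
  show "0 \<le> ?f k i" for k i by simp
  show "?f k sums (floor_powr_sum (t * real (Suc k)) / real (Suc k))" for k
    using t by (intro sums_divide sums_floor_powr(1)) simp
  show "(\<lambda>k. floor_powr_sum (t * real (Suc k)) / real (Suc k)) sums S"
    unfolding S_def by (intro summable_sums summable_floor_powr_sum_terms t)
  show "(\<lambda>k. ?f k i) sums - ln (1 - exp (- (t * ?\<sigma> i)))" for i
  proof -
    let ?x = "exp (- (t * ?\<sigma> i))"
    have "0 < ?\<sigma> i" unfolding of_nat_0_less_iff using floor_powr_bounds(4)[of "Suc i"] by linarith
    hence "0 < t * ?\<sigma> i" using t by (rule mult_pos_pos[rotated])
    hence "\<bar>- ?x\<bar> < 1" by simp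
    from sums_minus[OF ln_series'[OF this]]
    have "(\<lambda>n. ?x ^ n / real n) sums - ln (1 - ?x)" by simp
    \<comment> \<open>The dropped term at index 0 is a division by zero, hence 0.\<close>
    hence "(\<lambda>k. ?x ^ Suc k / real (Suc k)) sums - ln (1 - ?x)" by (subst sums_Suc_iff) simp
    moreover have "?x ^ Suc k = exp (- (t * real (Suc k) * ?\<sigma> i))" for k
      unfolding exp_of_nat_mult[symmetric] by (simp only: mult_ac mult_minus_right)
    ultimately show ?thesis by simp
  qed
qed

text \<open>Tannery's theorem. Writing t^(1/d) as (t k)^(1/d) k^(-1/d) makes the k-th term a
  function of t k, bounded and convergent to \<Gamma>(1 + 1/d), times the zeta term k^(-(1 +
  1/d)).\<close>

lemma tendsto_log_generating_function:
  "((\<lambda>t. t powr (1 / d) * (\<Sum>k. floor_powr_sum (t * real (Suc k)) / real (Suc k)))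
      \<longlongrightarrow> Gamma (1 + 1 / d) * zeta (1 + 1 / d)) (at_right 0)"
proof -
  let ?a = "\<lambda>k t. (t * real (Suc k)) powr (1 / d) * floor_powr_sum (t * real (Suc k))
                 * real (Suc k) powr (- (1 + 1 / d))"
  let ?b = "\<lambda>k. Gamma (1 + 1 / d) * real (Suc k) powr (- (1 + 1 / d))"
  let ?M = "\<lambda>k. 2 powr (1 / d) * Gamma (1 + 1 / d) * real (Suc k) powr (- (1 + 1 / d))"
  have lim: "(?a k \<longlongrightarrow> ?b k) (at_right 0)" for k
  proof -
    have "((\<lambda>t. t * real (Suc k)) \<longlongrightarrow> 0 * real (Suc k)) (at_right 0)"
      by (intro tendsto_mult tendsto_const) (simp add: tendsto_ident_at)
    moreover have "eventually (\<lambda>t. t * real (Suc k) \<in> {0<..} \<and> t * real (Suc k) \<noteq> 0) (at_right 0)"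
      using eventually_at_right_less by eventually_elim simp
    ultimately have "filterlim (\<lambda>t. t * real (Suc k)) (at_right 0) (at_right 0)"
      by (simp add: filterlim_at)
    from filterlim_compose[OF tendsto_powr_mult_floor_powr_sum this] show ?thesis
      by (intro tendsto_mult tendsto_const)
  qed
  have bound: "norm (?a k t) \<le> ?M k" if "0 < t" for k t
  proof -
    have tk: "0 < t * real (Suc k)" using that by simp
    have "?a k t \<le> ?M k" using powr_mult_floor_powr_sum_le[OF tk] by (rule mult_right_mono) simp
    thus ?thesis using floor_powr_sum_nonneg[OF tk] by simp
  qed
  have "eventually (\<lambda>(k, t). norm (?a k t) \<le> ?M k) (at_top \<times>\<^sub>F at_right 0)"
    using eventually_prodI[OF always_eventually eventually_at_right_less, of "\<lambda>_. True"]
    by (rule eventually_mono) (use bound in auto)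
  from tannerys_theorem[OF lim this summable_mult[OF summable_zeta_terms]]
  have "((\<lambda>t. \<Sum>k. ?a k t) \<longlongrightarrow> suminf ?b) (at_right 0)" by simp
  also have "suminf ?b = Gamma (1 + 1 / d) * zeta (1 + 1 / d)"
    unfolding zeta_def by (rule suminf_mult[OF summable_zeta_terms])
  finally show ?thesis
  proof (rule Lim_transform_eventually)
    show "eventually (\<lambda>t. (\<Sum>k. ?a k t)
        = t powr (1 / d) * (\<Sum>k. floor_powr_sum (t * real (Suc k)) / real (Suc k))) (at_right 0)"
      using eventually_at_right_less
    proof eventually_elim
      case (elim t)
      have "?a k t = t powr (1 / d) * (floor_powr_sum (t * real (Suc k)) / real (Suc k))" for k
      proof -
        have "real (Suc k) powr (1 / d) * real (Suc k) powr (- (1 + 1 / d)) = real (Suc k) powr (-1)"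
          unfolding powr_add[symmetric] by simp
        also have "\<dots> = 1 / real (Suc k)" by (simp add: powr_minus_divide)
        finally have "real (Suc k) powr (1 / d) * real (Suc k) powr (- (1 + 1 / d)) = 1 / real (Suc k)" .
        moreover have "?a k t = t powr (1 / d) * (floor_powr_sum (t * real (Suc k))
            * (real (Suc k) powr (1 / d) * real (Suc k) powr (- (1 + 1 / d))))"
          using elim by (simp only: powr_mult mult_ac of_nat_0_le_iff less_imp_le)
        ultimately show ?thesis by (simp only: times_divide_eq_right mult_1_right)
      qed
      moreover have "summable (\<lambda>k. floor_powr_sum (t * real (Suc k)) / real (Suc k))"
        using elim by (rule summable_floor_powr_sum_terms)
      ultimately show ?case by (simp only: suminf_mult)
    qed
  qed
qed

end

subsection \<open>Partitions into values of \<open>\<lfloor>x\<^sup>d\<rfloor>\<close>\<close>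

lemma finite_floor_powr_le:
  assumes d: "d > 0"
  shows "finite {a. nat \<lfloor>real a powr d\<rfloor> \<le> n}"
proof -
  have "a \<le> nat \<lceil>(real n + 1) powr (1 / d)\<rceil>" if a: "nat \<lfloor>real a powr d\<rfloor> \<le> n" for a
  proof (cases "a = 0")
    case False
    hence "real a powr d \<le> real n + 1" using floor_powr_bounds(2)[OF d, of a] a by linarith
    hence "(real a powr d) powr (1 / d) \<le> (real n + 1) powr (1 / d)"
      using d by (intro powr_mono2) auto
    hence "real a \<le> (real n + 1) powr (1 / d)" using d by (simp add: powr_powr)
    thus ?thesis by linarith
  qed simp
  thus ?thesis unfolding finite_nat_set_iff_bounded_le by blast
qed

lemma zeta_pos:
  assumes "d > 0"
  shows "0 < zeta (1 + 1 / d)"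
  unfolding zeta_def by (rule suminf_pos[OF summable_zeta_terms[OF assms]]) simp

theorem theorem1p1:
  fixes d :: real
  assumes "d > 0"
  shows "(\<lambda>n. ln (real (p_pow d n))) \<sim>[at_top] (\<lambda>n. c_pow d * real n powr (1 / (d + 1)))"
proof -
  let ?\<sigma> = "\<lambda>x. nat \<lfloor>real x powr d\<rfloor>"
  let ?L = "\<lambda>t. \<Sum>k. floor_powr_sum d (t * real (Suc k)) / real (Suc k)"
  let ?C = "Gamma (1 + 1 / d) * zeta (1 + 1 / d)"
  have pos: "\<forall>a>0. 0 < ?\<sigma> a"
    using floor_powr_bounds(4)[OF assms] by (metis less_le_trans zero_less_one)
  have fin: "finite {a. ?\<sigma> a \<le> n}" for n by (rule finite_floor_powr_le[OF assms])
  have "Gamma (1 + 1 / d) > 0" using assms by (intro Gamma_real_pos) (simp add: add_pos_pos)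
  hence C: "?C > 0" using zeta_pos[OF assms] by simp
  interpret monotone_exp_series "\<lambda>n. real (p_pow d n)" "\<lambda>t. exp (?L t)"
  proof
    show "mono (\<lambda>n. real (p_pow d n))"
      unfolding p_pow_def mono_iff_le_Suc
      \<comment> \<open>The hypothesis \<open>\<sigma> 1 = 1\<close> holds because 1^d = 1 for every
        d.\<close>
      using p_sigma_Suc_ge[OF pos fin] by simp
    show "0 < real (p_pow d 0)"
      unfolding p_pow_def using p_sigma_0_pos[OF pos fin] by simp
    show "(\<lambda>n. real (p_pow d n) * exp (- (t * real n))) sums exp (?L t)" if "t > 0" for t
      unfolding p_pow_def using sums_p_sigma[OF pos fin that log_generating_function[OF assms that]] .
  qed
  have "((\<lambda>t. t powr (1 / d) * ln (exp (?L t))) \<longlongrightarrow> ?C) (at_right 0)"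
    unfolding ln_exp by (rule tendsto_log_generating_function[OF assms])
  from ln_coeff_asymptotics[OF _ C this] assms
  have "(\<lambda>n. ln (real (p_pow d n)) / real n powr ((1 / d) / (1 + 1 / d)))
      \<longlonglongrightarrow> (1 + 1 / (1 / d)) * ((1 / d) * ?C) powr (1 / (1 + 1 / d))" by simp
  moreover have "(1 / d) / (1 + 1 / d) = 1 / (d + 1)" "1 / (1 + 1 / d) = d / (d + 1)"
    using assms by (simp_all add: field_simps)
  ultimately have "(\<lambda>n. ln (real (p_pow d n)) / real n powr (1 / (d + 1))) \<longlonglongrightarrow> c_pow d"
    by (simp add: c_pow_def add.commute mult.assoc)
  \<comment> \<open>A limit of the quotient yields asymptotic equivalence only if it is
    nonzero.\<close>
  moreover have "c_pow d \<noteq> 0" using C assms by (auto simp: c_pow_def)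
  ultimately show ?thesis by (rule asymp_equivI'_const)
qed

end
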